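(* Consider the system $\Sigma$ with transfer matrix $G(s)=C(sI_n-A)^{-1}B+D\in\mathbb{R}(s)^{p\times m}$, and assume $G(s)$ is left-invertible as a rational function matrix. Let $$2n_s:=\deg\Big(\det(sI_n-A)\,\det(-sI_n-A)\,\det\big(G(-s)^TG(s)\big)\Big),$$ i.e. twice $n_s$ is the degree of the numerator of $\det(G(-s)^TG(s))$ before pole-zero cancellation. Then the strongly reachable subspace $\mathcal{R}_s$ of $\Sigma$ has dimension $n_f:=n-n_s$.
   Context: $\Sigma$ is the system $\dot x=Ax+Bu$, $y=Cx+Du$ with $A\in\mathbb{R}^{n\times n}$, $B\in\mathbb{R}^{n\times m}$, $C\in\mathbb{R}^{p\times n}$, $D\in\mathbb{R}^{p\times m}$. Left-invertibility of $G$ implies $G(-s)^TG(s)$ is square and nonsingular, and the displayed product is an even polynomial. Impulsive-smooth inputs are distributions $u=u_{\rm reg}+\sum_{i=0}^k a_i\delta^{(i)}$ with $u_{\rm reg}$ the restriction to $\mathbb{R}_+$ of a $C^\infty$ function and $a_i\in\mathbb{R}^m$ ($\delta^{(i)}$ the derivatives of the Dirac distribution). A state $x_1\in\mathbb{R}^n$ is strongly reachable if there is an impulsive-smooth input $u$ such that the state trajectory from $x(0^-)=0$ satisfies $x(0^+)=x_1$ and the output is impulse-free (restriction to $\mathbb{R}_+$ of a $C^\infty$ function); the set of such states is the strongly reachable subspace $\mathcal{R}_s$. Equivalently (Hautus–Silverman), $\mathcal{R}_s$ is the stationary value of $\mathcal{R}_0=\{0\}$, $\mathcal{R}_{i+1}=\{Aw+B\alpha: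 w\in\mathcal{R}_i,\ \alpha\in\mathbb{R}^m,\ Cw+D\alpha=0\}$. *)

theory Defs
  imports "HOL-Analysis.Analysis" "HOL-Computational_Algebra.Polynomial"
    "HOL-Computational_Algebra.Fraction_Field"
begin

type_synonym ratfun = "real poly fract"

definition lift_mat :: "real^'c^'r \<Rightarrow> ratfun^'c^'r" where
  "lift_mat M = (\<chi> i j. Fract [:M $ i $ j:] 1)"

definition s_var :: ratfun where
  "s_var = Fract [:0, 1:] 1"

text \<open>Transfer matrix evaluated at a rational function sigma:
  G(sigma) = C (sigma I - A)^{-1} B + D.  G(s) is transfer_mat A B C D s_var,
  G(-s) is transfer_mat A B C D (- s_var).\<close>
definition transfer_mat ::
  "real^'n^'n \<Rightarrow> real^'m^'n \<Rightarrow> real^'n^'p \<Rightarrow> real^'m^'p \<Rightarrow> ratfun \<Rightarrow> ratfun^'m^'p" where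
  "transfer_mat A B C D \<sigma> =
     lift_mat C ** matrix_inv (mat \<sigma> - lift_mat A) ** lift_mat B + lift_mat D"

definition left_invertible :: "ratfun^'m^'p \<Rightarrow> bool" where
  "left_invertible G \<longleftrightarrow> (\<exists>L :: ratfun^'p^'m. L ** G = mat 1)"

text \<open>Hautus--Silverman recursion for the strongly reachable subspace.\<close>
primrec reach_seq ::
  "real^'n^'n \<Rightarrow> real^'m^'n \<Rightarrow> real^'n^'p \<Rightarrow> real^'m^'p \<Rightarrow> nat \<Rightarrow> (real^'n) set" where
  "reach_seq A B C D 0 = {0}"
| "reach_seq A B C D (Suc i) =
     {A *v w + B *v \<alpha> | w \<alpha>. w \<in> reach_seq A B C D i \<and> C *v w + D *v \<alpha> = 0}"

text \<open>The stationary value of the (increasing) recursion.\<close>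
definition strongly_reachable ::
  "real^'n^'n \<Rightarrow> real^'m^'n \<Rightarrow> real^'n^'p \<Rightarrow> real^'m^'p \<Rightarrow> (real^'n) set" where
  "strongly_reachable A B C D = (\<Union>i. reach_seq A B C D i)"

end

(* Let a = B \<alpha> with \<alpha> in ker D and \<alpha>_j = 1. Multiplying the input direction \<alpha> by s replaces
   the columns B \<alpha> and D \<alpha> = 0 by A a and C a, since s C (sI - A)^-1 a = C (sI - A)^-1 A a + C a.
   This multiplies det (G(-s)^T G(s)) by -s^2, and it removes exactly the direction a from the
   strongly reachable subspace: otherwise left invertibility of G would give a polynomial u with
   s u_j = -1. Hence both sides of the claim change by one, and iterating leads to an injective D.
   Then the strongly reachable subspace is 0, and the coefficient of s^(2n) is, up to sign,
   det (D^T D), which is nonzero. That the product is a polynomial follows by writing it as the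
   determinant of a polynomial block matrix whose Schur complement is G(-s)^T G(s). *)
theory Submission
  imports Defs "HOL-Computational_Algebra.Polynomial_Factorial"
begin

section \<open>Determinants of matrices with unit rows and of block matrices\<close>

text \<open>In the Leibniz sum, a permutation that moves an index outside \<open>range f\<close>
  picks a zero from a unit row. The others permute only the range, and conjugation by
  \<open>f\<close> matches them, sign included, with the permutations of \<open>'k\<close>. The
  choices \<open>Inl\<close> and \<open>Inr\<close> for \<open>f\<close> give the block
  determinants.\<close>

lemma det_unit_rows:
  fixes M :: "'a::comm_ring_1^'l^'l" and f :: "'k::finite \<Rightarrow> 'l::finite"
  assumes f: "inj f"
    and unit: "\<And>i j. i \<notin> range f \<Longrightarrow> M$i$j = (if i = j then 1 else 0)"
  shows "det M = det (\<chi> i j. M $ f i $ f j)"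
proof -
  let ?t = "\<lambda>p. of_int (sign p) * (\<Prod>i\<in>UNIV. M$i$p i)"
  let ?h = "map_permutation UNIV f"
  have bij: "bij_betw f UNIV (range f)"
    using f by (simp add: inj_on_imp_bij_betw)
  have bij': "bij_betw (inv f) (range f) UNIV"
    using f by (simp add: bij_betw_def inj_on_inv_into)
  have "det M = (\<Sum>p | p permutes UNIV. ?t p)"
    by (simp add: det_def)
  also have "\<dots> = (\<Sum>p | p permutes range f. ?t p)"
  proof (rule sum.mono_neutral_right)
    show "finite {p. p permutes (UNIV::'l set)}"
      by (simp add: finite_permutations)
    show "{p. p permutes range f} \<subseteq> {p. p permutes UNIV}"
      by (auto intro: permutes_subset)
    show "\<forall>p \<in> {p. p permutes UNIV} - {p. p permutes range f}. ?t p = 0"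
    proof
      fix p assume "p \<in> {p. p permutes UNIV} - {p. p permutes range f}"
      then obtain i where "i \<notin> range f" "p i \<noteq> i"
        unfolding permutes_def by blast
      then have "M$i$p i = 0"
        using unit[of i "p i"] by simp
      then have "(\<Prod>i\<in>UNIV. M$i$p i) = 0"
        by (intro prod_zero) auto
      then show "?t p = 0" by simp
    qed
  qed
  also have "\<dots> = (\<Sum>p | p permutes UNIV.
      of_int (sign p) * (\<Prod>i\<in>UNIV. M $ f i $ f (p i)))"
  proof (rule sum.reindex_bij_witness[where i = ?h and j = "map_permutation (range f) (inv f)"])
    fix p assume p: "p \<in> {p. p permutes range f}"
    show h: "?h (map_permutation (range f) (inv f) p) = p"
      by (rule map_permutation_compose_inv[OF bij']) (use p in \<open>auto simp: f_inv_into_f\<close>)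
    show q: "map_permutation (range f) (inv f) p \<in> {p. p permutes UNIV}"
      using p map_permutation_permutes[OF bij'] by auto
    define q where "q = map_permutation (range f) (inv f) p"
    have p_eq: "p = ?h q" and q_perm: "q permutes UNIV"
      using h q by (auto simp: q_def)
    have pf: "p (f i) = f (q i)" for i
      using f by (simp add: p_eq map_permutation_apply)
    \<comment> \<open>Here \<open>p\<close> fixes every index outside \<open>range f\<close>, so the
      factors dropped are diagonal entries 1.\<close>
    have "(\<Prod>i\<in>UNIV. M$i$p i) = (\<Prod>i\<in>range f. M$i$p i)"
      by (rule prod.mono_neutral_right) (use p unit in \<open>auto simp: permutes_def\<close>)
    also have "\<dots> = (\<Prod>i\<in>UNIV. M $ f i $ f (q i))"
      using f by (simp add: prod.reindex pf)
    moreover have "sign p = sign q"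
      using f q_perm by (simp add: p_eq sign_map_permutation)
    ultimately show "of_int (sign (map_permutation (range f) (inv f) p)) *
        (\<Prod>i\<in>UNIV. M $ f i $ f (map_permutation (range f) (inv f) p i)) = ?t p"
      by (simp add: q_def)
  next
    fix p assume p: "p \<in> {p. p permutes (UNIV::'k set)}"
    show "map_permutation (range f) (inv f) (?h p) = p"
      by (rule map_permutation_compose_inv[OF bij]) (use p f in auto)
    show "?h p \<in> {p. p permutes range f}"
      using p map_permutation_permutes[OF bij] by auto
  qed
  finally show ?thesis by (simp add: det_def)
qed

text \<open>Blocks are indexed by sum types, so that block matrices are ordinary matrices for
  \<open>det\<close> and \<open>**\<close>.\<close>

definition hstack :: "'a^'b^'r \<Rightarrow> 'a^'c^'r \<Rightarrow> 'a^('b + 'c)^'r" where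
  "hstack X Y = (\<chi> i j. case j of Inl k \<Rightarrow> X$i$k | Inr k \<Rightarrow> Y$i$k)"

definition vstack :: "'a^'c^'r \<Rightarrow> 'a^'c^'t \<Rightarrow> 'a^'c^('r + 't)" where
  "vstack X Y = (\<chi> i. case i of Inl k \<Rightarrow> X$k | Inr k \<Rightarrow> Y$k)"

abbreviation block_mat ::
  "'a^'b^'r \<Rightarrow> 'a^'c^'r \<Rightarrow> 'a^'b^'t \<Rightarrow> 'a^'c^'t \<Rightarrow> 'a^('b + 'c)^('r + 't)" where
  "block_mat P Q R S \<equiv> vstack (hstack P Q) (hstack R S)"

lemma hstack_nth [simp]: "hstack X Y $ i $ Inl j = X$i$j" "hstack X Y $ i $ Inr k = Y$i$k"
  by (simp_all add: hstack_def)

lemma vstack_nth [simp]: "vstack X Y $ Inl i = X$i" "vstack X Y $ Inr k = Y$k"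
  by (simp_all add: vstack_def)

lemma hstack_eq_iff: "X = hstack Y Z \<longleftrightarrow> (\<forall>i j. X$i$Inl j = Y$i$j) \<and> (\<forall>i j. X$i$Inr j = Z$i$j)"
  by (auto simp: vec_eq_iff hstack_def split: sum.splits)

lemma vstack_eq_iff: "X = vstack Y Z \<longleftrightarrow> (\<forall>i. X$Inl i = Y$i) \<and> (\<forall>i. X$Inr i = Z$i)"
  by (auto simp: vec_eq_iff vstack_def split: sum.splits)

lemma sum_UNIV_sum_type:
  "(\<Sum>i\<in>(UNIV :: ('a::finite + 'b::finite) set). g i) = (\<Sum>i\<in>UNIV. g (Inl i)) + (\<Sum>i\<in>UNIV. g (Inr i))"
  by (subst UNIV_Plus_UNIV[symmetric], subst sum.Plus) auto

lemma hstack_mult_vstack: "hstack X Y ** vstack Z W = X ** Z + Y ** W"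
  for X :: "'a::semiring_1^'b^'r"
  by (simp add: vec_eq_iff matrix_matrix_mult_def sum_UNIV_sum_type)

lemma vstack_mult: "vstack X Y ** Z = vstack (X ** Z) (Y ** Z)"
  for X :: "'a::semiring_1^'b^'r"
  by (simp add: vstack_eq_iff matrix_matrix_mult_def)

lemma mult_hstack: "X ** hstack Y Z = hstack (X ** Y) (X ** Z)"
  for X :: "'a::semiring_1^'b^'r"
  by (simp add: hstack_eq_iff matrix_matrix_mult_def)

lemma hstack_add: "hstack X Y + hstack Z W = hstack (X + Z) (Y + W)"
  by (simp add: hstack_eq_iff)

lemmas stack_mult = hstack_mult_vstack vstack_mult mult_hstack hstack_add

lemma det_block_unit_lower: "det (block_mat P Q 0 (mat 1)) = det P"
  for P :: "'a::comm_ring_1^'n^'n"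
proof (subst det_unit_rows[where f = Inl])
  fix i :: "'n + 'b" and j :: "'n + 'b"
  assume "i \<notin> range Inl"
  then obtain k where "i = Inr k" by (cases i) auto
  then show "block_mat P Q 0 (mat 1) $ i $ j = (if i = j then 1 else 0)"
    by (cases j) (auto simp: mat_def)
qed simp_all

lemma det_block_unit_upper: "det (block_mat (mat 1) 0 R S) = det S"
  for S :: "'a::comm_ring_1^'n^'n"
proof (subst det_unit_rows[where f = Inr])
  fix i :: "'b + 'n" and j :: "'b + 'n"
  assume "i \<notin> range Inr"
  then obtain k where "i = Inl k" by (cases i) auto
  then show "block_mat (mat 1) 0 R S $ i $ j = (if i = j then 1 else 0)"
    by (cases j) (auto simp: mat_def)
qed simp_all

lemma det_block_lower_triangular: "det (block_mat P 0 R S) = det P * det S"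
  for P :: "'a::comm_ring_1^'n^'n"
proof -
  have "block_mat P 0 R S = block_mat P 0 0 (mat 1) ** block_mat (mat 1) 0 R S"
    by (simp add: stack_mult)
  then show ?thesis
    by (simp add: det_mul det_block_unit_lower det_block_unit_upper)
qed

text \<open>\<open>X\<close> stands in for P^-1 Q: splitting off a unit upper triangular factor
  clears the block \<open>Q\<close> and leaves the Schur complement.\<close>

lemma det_block_schur:
  fixes P :: "'a::comm_ring_1^'n^'n"
  assumes "P ** X = Q"
  shows "det (block_mat P Q R S) = det P * det (S - R ** X)"
proof -
  have "block_mat P Q R S = block_mat P 0 R (S - R ** X) ** block_mat (mat 1) X 0 (mat 1)"
    by (simp add: stack_mult assms)
  then show ?thesis
    by (simp add: det_mul det_block_unit_lower det_block_lower_triangular)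
qed

section \<open>Degrees and top coefficients of polynomial determinants\<close>

text \<open>The bounds need not be attained, so both sides may vanish. In the Cauchy product every
  index other than \<open>a\<close> makes one of the two factors exceed its bound.\<close>

lemma coeff_mult_degree_bounds:
  assumes "degree p \<le> a" "degree q \<le> b"
  shows "coeff (p * q) (a + b) = coeff p a * coeff q b"
proof -
  have "coeff (p * q) (a + b) = (\<Sum>i\<le>a + b. coeff p i * coeff q (a + b - i))"
    by (simp add: coeff_mult)
  also have "\<dots> = (\<Sum>i\<in>{a}. coeff p i * coeff q (a + b - i))"
  proof (rule sum.mono_neutral_right)
    show "\<forall>i\<in>{..a + b} - {a}. coeff p i * coeff q (a + b - i) = 0"
    proof
      fix i assume "i \<in> {..a + b} - {a}"
      then consider "i > a" | "a + b - i > b" by force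
      then show "coeff p i * coeff q (a + b - i) = 0"
        using assms by cases (auto simp: coeff_eq_0)
    qed
  qed auto
  finally show ?thesis by simp
qed

lemma prod_degree_bounds:
  fixes f :: "'b \<Rightarrow> 'a::comm_semiring_1 poly"
  assumes "finite S" "\<And>i. i \<in> S \<Longrightarrow> degree (f i) \<le> r i"
  shows "degree (prod f S) \<le> sum r S"
    and "coeff (prod f S) (sum r S) = (\<Prod>i\<in>S. coeff (f i) (r i))"
proof -
  have "degree (prod f S) \<le> sum r S \<and> coeff (prod f S) (sum r S) = (\<Prod>i\<in>S. coeff (f i) (r i))"
    using assms
  proof (induction S rule: finite_induct)
    case (insert x S)
    then have "degree (f x * prod f S) \<le> r x + sum r S"
      by (intro order_trans[OF degree_mult_le] add_mono) auto
    with insert show ?case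
      by (simp add: coeff_mult_degree_bounds)
  qed simp
  then show "degree (prod f S) \<le> sum r S"
    and "coeff (prod f S) (sum r S) = (\<Prod>i\<in>S. coeff (f i) (r i))" by auto
qed

text \<open>Turns the sign into a choice between \<open>q\<close> and \<open>- q\<close>, so that
  degree, \<open>coeff\<close> and \<open>to_fract\<close> pass through the Leibniz formula.\<close>

lemma of_int_sign_mult: "of_int (sign p) * q = (if sign p = 1 then q else - q)"
  for q :: "'a::comm_ring_1"
  by (cases p rule: sign_cases) auto

text \<open>Each Leibniz term takes one entry from every row, so the row bounds add up, and the
  coefficients at the total bound form the Leibniz sum of the row-wise top coefficients.\<close>

lemma det_row_degree_bounds:
  fixes M :: "'a::comm_ring_1 poly^'n^'n"
  assumes "\<And>i j. degree (M$i$j) \<le> r i"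
  shows "degree (det M) \<le> sum r UNIV"
    and "coeff (det M) (sum r UNIV) = det (\<chi> i j. coeff (M$i$j) (r i))"
proof -
  have d: "degree (\<Prod>i\<in>UNIV. M$i$p i) \<le> sum r UNIV"
    and c: "coeff (\<Prod>i\<in>UNIV. M$i$p i) (sum r UNIV) = (\<Prod>i\<in>UNIV. coeff (M$i$p i) (r i))" for p
    by (rule prod_degree_bounds; simp add: assms)+
  show "degree (det M) \<le> sum r UNIV"
    unfolding det_def of_int_sign_mult by (intro degree_sum_le) (auto simp: finite_permutations d)
  show "coeff (det M) (sum r UNIV) = det (\<chi> i j. coeff (M$i$j) (r i))"
    unfolding det_def of_int_sign_mult coeff_sum by (intro sum.cong) (auto simp: c)
qed

section \<open>From real and polynomial matrices to matrices of rational functions\<close>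

lemma to_fract_prod: "to_fract (\<Prod>i\<in>S. f i) = (\<Prod>i\<in>S. to_fract (f i))"
  by (induction S rule: infinite_finite_induct) auto

definition fract_mat :: "'a::idom^'c^'r \<Rightarrow> 'a fract^'c^'r" where
  "fract_mat M = (\<chi> i j. to_fract (M$i$j))"

lemma det_fract_mat: "det (fract_mat M) = to_fract (det M)"
  unfolding det_def of_int_sign_mult fract_mat_def to_fract_sum
  by (intro sum.cong) (auto simp: to_fract_prod)

lemma fract_mat_hstack: "fract_mat (hstack X Y) = hstack (fract_mat X) (fract_mat Y)"
  by (simp add: hstack_eq_iff fract_mat_def)

lemma fract_mat_vstack: "fract_mat (vstack X Y) = vstack (fract_mat X) (fract_mat Y)"
  by (simp add: vstack_eq_iff fract_mat_def)

lemma fract_mat_diff: "fract_mat (X - Y) = fract_mat X - fract_mat Y"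
  by (simp add: vec_eq_iff fract_mat_def)

lemma fract_mat_minus: "fract_mat (- X) = - fract_mat X"
  by (simp add: vec_eq_iff fract_mat_def)

lemma fract_mat_0: "fract_mat 0 = 0"
  by (simp add: vec_eq_iff fract_mat_def)

lemma fract_mat_mat: "fract_mat (mat c) = mat (to_fract c)"
  by (simp add: vec_eq_iff fract_mat_def mat_def)

definition const_mat :: "real^'c^'r \<Rightarrow> real poly^'c^'r" where
  "const_mat M = (\<chi> i j. [:M$i$j:])"

lemma fract_const_mat: "fract_mat (const_mat M) = lift_mat M"
  by (simp add: vec_eq_iff fract_mat_def const_mat_def lift_mat_def to_fract_def)

definition lift_vec :: "real^'n \<Rightarrow> ratfun^'n" where
  "lift_vec v = (\<chi> i. to_fract [:v$i:])"

lemma pCons_sum: "[:\<Sum>i\<in>S. f i:] = (\<Sum>i\<in>S. [:f i:])"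
proof (induction S rule: infinite_finite_induct)
  case (insert x S)
  then show ?case by (simp flip: insert.IH)
qed simp_all

lemma lift_mat_nth: "lift_mat M $ i $ j = to_fract [:M$i$j:]"
  by (simp add: lift_mat_def to_fract_def)

lemma lift_mat_mult: "lift_mat (M ** N) = lift_mat M ** lift_mat N"
  by (simp add: vec_eq_iff lift_mat_nth matrix_matrix_mult_def pCons_sum mult.commute
      flip: to_fract_mult)

lemma lift_mat_transpose: "lift_mat (transpose M) = transpose (lift_mat M)"
  by (simp add: vec_eq_iff lift_mat_nth transpose_def)

lemma lift_vec_mult: "lift_vec (M *v v) = lift_mat M *v lift_vec v"
  by (simp add: vec_eq_iff lift_mat_nth lift_vec_def matrix_vector_mult_def pCons_sum mult.commute
      flip: to_fract_mult)

lemma lift_vec_add: "lift_vec (v + w) = lift_vec v + lift_vec w"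
  by (simp add: vec_eq_iff lift_vec_def flip: to_fract_add)

lemma lift_vec_0 [simp]: "lift_vec 0 = 0"
  by (simp add: vec_eq_iff lift_vec_def)

lemma s_var_eq: "s_var = to_fract [:0, 1:]" and minus_s_var_eq: "- s_var = to_fract [:0, -1:]"
  by (simp_all add: s_var_def to_fract_def)

lemma s_var_nz [simp]: "s_var \<noteq> 0"
  by (simp add: s_var_eq)

section \<open>Nonsingularity of sI - A and -sI - A\<close>

lemma matrix_inv_det_nz:
  fixes M :: "'a::field^'n^'n"
  assumes "det M \<noteq> 0"
  shows "M ** matrix_inv M = mat 1" "matrix_inv M ** M = mat 1"
proof -
  have "\<exists>N. M ** N = mat 1 \<and> N ** M = mat 1"
    using assms by (simp add: invertible_det_nz[symmetric] invertible_def)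
  then have "M ** matrix_inv M = mat 1 \<and> matrix_inv M ** M = mat 1"
    unfolding matrix_inv_def by (rule someI_ex)
  then show "M ** matrix_inv M = mat 1" "matrix_inv M ** M = mat 1" by auto
qed

text \<open>With n the size of \<open>A\<close>, the coefficient of s^n in the determinant is e^n.
  The values 1 and -1 of \<open>e\<close> give the two pencils needed.\<close>

lemma det_pencil_nz:
  assumes "\<sigma> = to_fract [:0, e:]" "e \<noteq> 0"
  shows "det (mat \<sigma> - lift_mat A) \<noteq> 0"
proof -
  let ?M = "mat [:0, e:] - const_mat A"
  have "degree (?M$i$j) \<le> 1" for i j
    by (simp add: mat_def const_mat_def)
  then have "coeff (det ?M) (\<Sum>i\<in>(UNIV::'a set). 1) = det (\<chi> i j. coeff (?M$i$j) 1)"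
    by (rule det_row_degree_bounds(2))
  also have "\<dots> = (\<Prod>i\<in>(UNIV::'a set). e)"
    by (subst det_diagonal) (auto simp: mat_def const_mat_def)
  also have "\<dots> \<noteq> 0" using assms by simp
  finally have "det ?M \<noteq> 0" by (metis coeff_0)
  moreover have "mat \<sigma> - lift_mat A = fract_mat ?M"
    by (simp add: fract_mat_diff fract_mat_mat fract_const_mat assms)
  ultimately show ?thesis by (simp add: det_fract_mat)
qed

lemma det_pencil_s_var_nz:
  "det (mat s_var - lift_mat A) \<noteq> 0" "det (mat (- s_var) - lift_mat A) \<noteq> 0"
  by (rule det_pencil_nz[OF s_var_eq] det_pencil_nz[OF minus_s_var_eq]; simp)+

section \<open>The product in the claim as a polynomial determinant\<close>

lemma matrix_mult_minus_right: "X ** (- Y) = - (X ** Y)"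
  and matrix_mult_minus_left: "(- X) ** Y = - (X ** Y)"
  for X :: "'a::ring_1^'b^'c"
  by (simp_all add: vec_eq_iff matrix_matrix_mult_def sum_negf)

lemma matrix_mult_add_right: "(X + Y) ** Z = X ** Z + Y ** Z"
  for X :: "'a::ring_1^'b^'c"
  by (simp add: vec_eq_iff matrix_matrix_mult_def sum.distrib algebra_simps)

lemma transpose_add: "transpose (X + Y) = transpose X + transpose Y"
  by (simp add: vec_eq_iff transpose_def)

lemma transpose_diff: "transpose (X - Y) = transpose X - transpose Y"
  by (simp add: vec_eq_iff transpose_def)

text \<open>The system matrix of the cascade of \<open>\<Sigma>\<close> with its adjoint, whose transfer matrix is
  \<open>G(-s)\<^sup>T G(s)\<close>.\<close>
definition cascade_pencil ::
  "real^'n^'n \<Rightarrow> real^'m^'n \<Rightarrow> real^'n^'p \<Rightarrow> real^'m^'p \<Rightarrow> real poly^(('n + 'n) + 'm)^(('n + 'n) + 'm)"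
where
  "cascade_pencil A B C D =
     block_mat
       (block_mat (mat [:0, 1:] - const_mat A) 0
                  (- const_mat (transpose C ** C)) (mat [:0, -1:] - const_mat (transpose A)))
       (vstack (- const_mat B) (- const_mat (transpose C ** D)))
       (hstack (const_mat (transpose D ** C)) (const_mat (transpose B)))
       (const_mat (transpose D ** D))"

text \<open>Over the field of rational functions both pencils are invertible, so the state blocks
  can be eliminated. Their determinant gives the first two factors, and the Schur complement gives
  the third.\<close>

lemma det_cascade_pencil:
  fixes A :: "real^'n^'n" and B :: "real^'m^'n" and C :: "real^'n^'p" and D :: "real^'m^'p"
  shows "to_fract (det (cascade_pencil A B C D)) =
    det (mat s_var - lift_mat A) * det (mat (- s_var) - lift_mat A)
      * det (transpose (transfer_mat A B C D (- s_var)) ** transfer_mat A B C D s_var)"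
proof -
  define a b c d where abcd: "a = lift_mat A" "b = lift_mat B" "c = lift_mat C" "d = lift_mat D"
  define P1 P2 where P12: "P1 = mat s_var - a" "P2 = mat (- s_var) - a"
  define R1 R2 where R12: "R1 = matrix_inv P1" "R2 = matrix_inv P2"
  define G1 G2 where G12: "G1 = c ** R1 ** b + d" "G2 = c ** R2 ** b + d"
  let ?P = "block_mat P1 0 (- (transpose c ** c)) (transpose P2)"
  let ?Q = "vstack (- b) (- (transpose c ** d))"
  let ?R = "hstack (transpose d ** c) (transpose b)"
  \<comment> \<open>The solution of \<open>?P ** ?X = ?Q\<close> by forward substitution: up to
    sign, the state response of the system to its input, then that of the adjoint system driven by
    the output \<open>G1\<close>.\<close>
  let ?X = "vstack (- (R1 ** b)) (- (transpose R2 ** transpose c ** G1))"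
  have fract: "fract_mat (cascade_pencil A B C D) = block_mat ?P ?Q ?R (transpose d ** d)"
    by (simp add: cascade_pencil_def fract_mat_hstack fract_mat_vstack fract_mat_diff
        fract_mat_minus fract_mat_0 fract_mat_mat fract_const_mat lift_mat_mult lift_mat_transpose
        abcd P12 transpose_diff flip: s_var_eq minus_s_var_eq)
  have i1: "P1 ** R1 = mat 1"
    unfolding R12 by (rule matrix_inv_det_nz) (simp add: P12 abcd det_pencil_s_var_nz)
  have "R2 ** P2 = mat 1"
    unfolding R12 by (rule matrix_inv_det_nz) (simp add: P12 abcd det_pencil_s_var_nz)
  then have i2: "transpose P2 ** transpose R2 = mat 1"
    by (simp flip: matrix_transpose_mul)
  have "?P ** ?X = vstack (- b) (transpose c ** c ** R1 ** b - transpose c ** G1)"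
    by (simp add: stack_mult matrix_mult_minus_right matrix_mult_minus_left matrix_mul_assoc i1 i2)
  then have "?P ** ?X = ?Q"
    by (simp add: G12 matrix_add_ldistrib matrix_mul_assoc)
  then have "det (block_mat ?P ?Q ?R (transpose d ** d))
      = det ?P * det (transpose d ** d - ?R ** ?X)"
    by (rule det_block_schur)
  also have "transpose d ** d - ?R ** ?X
      = transpose d ** (c ** R1 ** b + d) + transpose (c ** R2 ** b) ** G1"
    by (simp add: stack_mult matrix_mult_minus_right matrix_mul_assoc matrix_add_ldistrib
        matrix_transpose_mul)
  also have "\<dots> = transpose G2 ** G1"
    by (simp add: G12 transpose_add matrix_mult_add_right)
  also have "det ?P = det P1 * det P2"
    by (simp add: det_block_lower_triangular)
  finally show ?thesis
    unfolding det_fract_mat[symmetric] fract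
    by (simp add: transfer_mat_def G12 R12 P12 abcd)
qed

section \<open>The degree for injective D\<close>

text \<open>If D^T D v = 0, then D v is orthogonal to itself, hence zero.\<close>

lemma det_transpose_mult_self_nz:
  fixes D :: "real^'m^'p"
  assumes "\<And>v. D *v v = 0 \<Longrightarrow> v = 0"
  shows "det (transpose D ** D) \<noteq> 0"
proof -
  have "v = 0" if "(transpose D ** D) *v v = 0" for v
  proof -
    have "(D *v v) v* D = 0"
      using that by (simp flip: matrix_vector_mul_assoc)
    then have "inner (D *v v) (D *v v) = 0"
      by (metis dot_lmul_matrix inner_zero_left)
    then show ?thesis using assms by simp
  qed
  then show ?thesis
    by (simp add: invertible_det_nz[symmetric] invertible_left_inverse matrix_left_invertible_ker)
qed

lemma degree_det_cascade_pencil_injective: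
  fixes A :: "real^'n^'n" and B :: "real^'m^'n" and C :: "real^'n^'p" and D :: "real^'m^'p"
  assumes "\<And>v. D *v v = 0 \<Longrightarrow> v = 0"
  shows "det (cascade_pencil A B C D) \<noteq> 0"
    and "degree (det (cascade_pencil A B C D)) = 2 * CARD('n)"
proof -
  let ?M = "cascade_pencil A B C D"
  \<comment> \<open>The 2n state rows are linear in s, the last m rows are constant.\<close>
  define r :: "('n + 'n) + 'm \<Rightarrow> nat" where "r = case_sum (\<lambda>_. 1) (\<lambda>_. 0)"
  have deg: "degree (?M$i$j) \<le> r i" for i j
    unfolding cascade_pencil_def r_def const_mat_def mat_def hstack_def vstack_def
    by (auto split: sum.split)
  have sum_r: "sum r UNIV = 2 * CARD('n)"
    by (simp add: sum_UNIV_sum_type r_def)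
  \<comment> \<open>In the state rows only the coefficients of s and -s survive; the constant rows
    survive whole. The result is block triangular with diagonal I, -I, D^T D.\<close>
  have "(\<chi> i j. coeff (?M$i$j) (r i)) =
      block_mat (block_mat (mat 1) 0 0 (mat (- 1))) 0
        (hstack (transpose D ** C) (transpose B)) (transpose D ** D)"
    unfolding cascade_pencil_def r_def const_mat_def mat_def hstack_def vstack_def
    by (auto simp: vec_eq_iff split: sum.split)
  then have "coeff (det ?M) (sum r UNIV) = det (mat (- 1) :: real^'n^'n) * det (transpose D ** D)"
    by (simp add: det_row_degree_bounds(2)[OF deg] det_block_lower_triangular)
  moreover have "det (mat (- 1) :: real^'n^'n) \<noteq> 0"
    by (subst det_diagonal) (auto simp: mat_def)
  ultimately have "coeff (det ?M) (2 * CARD('n)) \<noteq> 0"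
    using det_transpose_mult_self_nz[OF assms] by (simp add: sum_r)
  moreover have "degree (det ?M) \<le> 2 * CARD('n)"
    using det_row_degree_bounds(1)[OF deg] by (simp add: sum_r)
  ultimately show "det ?M \<noteq> 0" "degree (det ?M) = 2 * CARD('n)"
    by (auto intro!: antisym le_degree)
qed

section \<open>The strongly reachable subspace and its induction principle\<close>

lemma reach_seq_Suc_mono: "reach_seq A B C D i \<subseteq> reach_seq A B C D (Suc i)"
proof (induction i)
  case 0
  show ?case by (auto intro!: exI[of _ 0])
next
  case (Suc i)
  show ?case
  proof
    fix x assume "x \<in> reach_seq A B C D (Suc i)"
    then obtain w v where wv: "x = A *v w + B *v v" "w \<in> reach_seq A B C D i" "C *v w + D *v v = 0"
      by auto
    with Suc have "w \<in> reach_seq A B C D (Suc i)" by blast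
    with wv show "x \<in> reach_seq A B C D (Suc (Suc i))"
      unfolding reach_seq.simps(2)[of A B C D "Suc i"] by blast
  qed
qed

lemma reach_seq_mono: "i \<le> k \<Longrightarrow> reach_seq A B C D i \<subseteq> reach_seq A B C D k"
  by (rule lift_Suc_mono_le[of "reach_seq A B C D"]) (rule reach_seq_Suc_mono)

lemma subspace_reach_seq: "subspace (reach_seq A B C D i)"
proof (induction i)
  case 0
  then show ?case by simp
next
  case (Suc i)
  show ?case
  proof (rule subspaceI)
    show "0 \<in> reach_seq A B C D (Suc i)"
      using Suc subspace_0 reach_seq_Suc_mono by blast
  next
    fix x y assume "x \<in> reach_seq A B C D (Suc i)" "y \<in> reach_seq A B C D (Suc i)"
    then obtain w v w' v' where
      "x = A *v w + B *v v" "w \<in> reach_seq A B C D i" "C *v w + D *v v = 0"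
      "y = A *v w' + B *v v'" "w' \<in> reach_seq A B C D i" "C *v w' + D *v v' = 0"
      by auto
    then have "x + y = A *v (w + w') + B *v (v + v')" "w + w' \<in> reach_seq A B C D i"
      "C *v (w + w') + D *v (v + v') = 0"
      using Suc by (auto simp: subspace_add algebra_simps)
    then show "x + y \<in> reach_seq A B C D (Suc i)" by auto
  next
    fix k x assume "x \<in> reach_seq A B C D (Suc i)"
    then obtain w v where
      "x = A *v w + B *v v" "w \<in> reach_seq A B C D i" "C *v w + D *v v = 0"
      by auto
    then have "k *\<^sub>R x = A *v (k *\<^sub>R w) + B *v (k *\<^sub>R v)" "k *\<^sub>R w \<in> reach_seq A B C D i"
      "C *v (k *\<^sub>R w) + D *v (k *\<^sub>R v) = 0"
      using Suc by (auto simp: matrix_vector_mult_scaleR subspace_scale scaleR_add_right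
          simp flip: scaleR_add_right)
    then show "k *\<^sub>R x \<in> reach_seq A B C D (Suc i)" by auto
  qed
qed

lemma subspace_strongly_reachable: "subspace (strongly_reachable A B C D)"
proof (rule subspaceI)
  show "0 \<in> strongly_reachable A B C D"
    by (auto simp: strongly_reachable_def intro!: exI[of _ 0])
next
  fix x y assume "x \<in> strongly_reachable A B C D" "y \<in> strongly_reachable A B C D"
  then obtain i k where "x \<in> reach_seq A B C D i" "y \<in> reach_seq A B C D k"
    by (auto simp: strongly_reachable_def)
  \<comment> \<open>The stages increase, so two members of the union share a stage, which is a
    subspace.\<close>
  then have "x \<in> reach_seq A B C D (max i k)" "y \<in> reach_seq A B C D (max i k)"
    using reach_seq_mono[of i "max i k" A B C D] reach_seq_mono[of k "max i k" A B C D] by auto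
  then have "x + y \<in> reach_seq A B C D (max i k)"
    by (rule subspace_add[OF subspace_reach_seq])
  then show "x + y \<in> strongly_reachable A B C D"
    by (auto simp: strongly_reachable_def)
next
  fix c x assume "x \<in> strongly_reachable A B C D"
  then show "c *\<^sub>R x \<in> strongly_reachable A B C D"
    using subspace_scale[OF subspace_reach_seq] by (fastforce simp: strongly_reachable_def)
qed

lemma strongly_reachable_step:
  assumes "w \<in> strongly_reachable A B C D" "C *v w + D *v v = 0"
  shows "A *v w + B *v v \<in> strongly_reachable A B C D"
proof -
  obtain i where "w \<in> reach_seq A B C D i"
    using assms by (auto simp: strongly_reachable_def)
  then have "A *v w + B *v v \<in> reach_seq A B C D (Suc i)"
    using assms by auto
  then show ?thesis unfolding strongly_reachable_def by blast
qed

lemma strongly_reachable_induct [consumes 1, case_names zero step]: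
  assumes "x \<in> strongly_reachable A B C D"
    and "Q 0"
    and "\<And>w v. Q w \<Longrightarrow> C *v w + D *v v = 0 \<Longrightarrow> Q (A *v w + B *v v)"
  shows "Q x"
proof -
  have "\<forall>x \<in> reach_seq A B C D i. Q x" for i
    by (induction i) (use assms(2,3) in auto)
  then show ?thesis using assms(1) by (auto simp: strongly_reachable_def)
qed

section \<open>The resolvent identity and polynomial inputs\<close>

lemma mat_mult_vec: "mat c *v x = c *s x"
  for x :: "'a::comm_semiring_1^'n"
  by (simp add: vec_eq_iff mat_def matrix_vector_mult_def if_distrib if_distribR cong: if_cong)

text \<open>A rearrangement of R (\<sigma> I - A) x = x. It trades a factor \<open>A\<close> for a
  factor \<sigma> at the cost of a constant term.\<close>

lemma resolvent_mult:
  assumes "det (mat \<sigma> - lift_mat A) \<noteq> 0"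
  shows "matrix_inv (mat \<sigma> - lift_mat A) *v (lift_mat A *v x)
    = \<sigma> *s (matrix_inv (mat \<sigma> - lift_mat A) *v x) - x"
proof -
  let ?R = "matrix_inv (mat \<sigma> - lift_mat A)"
  have "x = ?R *v ((mat \<sigma> - lift_mat A) *v x)"
    by (simp add: matrix_vector_mul_assoc matrix_inv_det_nz[OF assms])
  also have "\<dots> = \<sigma> *s (?R *v x) - ?R *v (lift_mat A *v x)"
    by (simp add: matrix_vector_mult_diff_rdistrib matrix_vector_mult_diff_distrib mat_mult_vec
        vector_scalar_commute)
  finally show ?thesis by (simp add: algebra_simps)
qed

lemma transfer_mat_mult_vec:
  "transfer_mat A B C D \<sigma> *v x
    = lift_mat C *v (matrix_inv (mat \<sigma> - lift_mat A) *v (lift_mat B *v x)) + lift_mat D *v x"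
  by (simp add: transfer_mat_def matrix_vector_mult_add_rdistrib matrix_vector_mul_assoc
      matrix_mul_assoc)

text \<open>\<open>- u\<close> is the Laplace transform of a purely impulsive input that steers \<open>0\<close> to
  \<open>x\<close> and leaves the output free of impulses.\<close>
lemma strongly_reachable_polynomial_input:
  fixes A :: "real^'n^'n" and B :: "real^'m^'n" and C :: "real^'n^'p" and D :: "real^'m^'p"
  assumes "x \<in> strongly_reachable A B C D"
  shows "\<exists>u :: real poly^'m. transfer_mat A B C D s_var *v (\<chi> i. to_fract (u$i))
    = - (lift_mat C *v (matrix_inv (mat s_var - lift_mat A) *v lift_vec x))"
  using assms
proof (induction rule: strongly_reachable_induct)
  case zero
  have "(\<chi> i. to_fract ((0 :: real poly^'m)$i)) = 0"
    by (simp add: vec_eq_iff)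
  then show ?case
    by (intro exI[of _ 0]) simp
next
  case (step w v)
  let ?G = "transfer_mat A B C D s_var"
  let ?R = "matrix_inv (mat s_var - lift_mat A)"
  from step.IH obtain u :: "real poly^'m" where
    u: "?G *v (\<chi> i. to_fract (u$i)) = - (lift_mat C *v (?R *v lift_vec w))" by blast
  have out: "lift_mat C *v lift_vec w + lift_mat D *v lift_vec v = 0"
    using step.hyps by (simp flip: lift_vec_mult lift_vec_add)
  have Gv: "?G *v lift_vec v
      = lift_mat C *v (?R *v (lift_mat B *v lift_vec v)) + lift_mat D *v lift_vec v"
    by (rule transfer_mat_mult_vec)
  have "lift_mat C *v (?R *v lift_vec (A *v w + B *v v))
      = s_var *s (lift_mat C *v (?R *v lift_vec w)) - lift_mat C *v lift_vec w
        + lift_mat C *v (?R *v (lift_mat B *v lift_vec v))"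
    by (simp add: lift_vec_add lift_vec_mult matrix_vector_right_distrib
        resolvent_mult[OF det_pencil_s_var_nz(1)] matrix_vector_mult_diff_distrib vector_scalar_commute)
  \<comment> \<open>The constraint C w + D v = 0 turns the leftover - C w into D v, which completes
    the transfer function applied to v.\<close>
  also have "\<dots> = s_var *s (lift_mat C *v (?R *v lift_vec w)) + ?G *v lift_vec v"
    using out unfolding Gv by (simp add: algebra_simps eq_neg_iff_add_eq_0)
  also have "\<dots> = - (?G *v (s_var *s (\<chi> i. to_fract (u$i)) - lift_vec v))"
    using u by (simp add: vector_scalar_commute matrix_vector_mult_diff_distrib)
  \<comment> \<open>The new witness s u - v is again polynomial.\<close>
  also have "s_var *s (\<chi> i. to_fract (u$i)) - lift_vec v
      = (\<chi> i. to_fract ((\<chi> i. [:0, 1:] * u$i - [:v$i:])$i))"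
    by (simp add: vec_eq_iff lift_vec_def s_var_eq del: mult_pCons_left mult_pCons_right)
  finally have "?G *v (\<chi> i. to_fract ((\<chi> i. [:0, 1:] * u$i - [:v$i:])$i))
      = - (lift_mat C *v (?R *v lift_vec (A *v w + B *v v)))" by simp
  then show ?case by blast
qed

section \<open>Replacing one input column\<close>

definition replace_col :: "'a^'c^'r \<Rightarrow> 'c \<Rightarrow> 'a^'r \<Rightarrow> 'a^'c^'r" where
  "replace_col M j x = (\<chi> i k. if k = j then x$i else M$i$k)"

lemma mult_replace_col: "X ** replace_col M j x = replace_col (X ** M) j (X *v x)"
  by (simp add: vec_eq_iff replace_col_def matrix_matrix_mult_def matrix_vector_mult_def)

lemma replace_col_add: "replace_col M j x + replace_col N j y = replace_col (M + N) j (x + y)"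
  by (simp add: vec_eq_iff replace_col_def)

lemma lift_mat_replace_col: "lift_mat (replace_col M j x) = replace_col (lift_mat M) j (lift_vec x)"
  by (simp add: vec_eq_iff replace_col_def lift_mat_nth lift_vec_def)

lemma det_replace_col_mat_1: "det (replace_col (mat 1) j x) = x$j"
  for x :: "'a::field^'n"
  using cramer_lemma[of j "mat 1" x] unfolding replace_col_def matrix_vector_mul_lid by simp

lemma replace_col_mult_vec:
  fixes M :: "'a::comm_ring_1^'c^'r"
  shows "replace_col M j x *v v = M *v (v - axis j (v$j)) + v$j *s x"
proof -
  have "(\<Sum>k\<in>UNIV. (if k = j then x$i else M$i$k) * v$k)
      = (\<Sum>k\<in>UNIV. M$i$k * (v - axis j (v$j))$k) + v$j * x$i" for i
    by (subst (1 2) sum.remove[of UNIV j]) (auto simp: axis_def mult.commute intro!: sum.cong)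
  then show ?thesis
    by (simp add: vec_eq_iff replace_col_def matrix_vector_mult_def)
qed

text \<open>If \<open>D \<alpha> = 0\<close>, then \<open>s G(s) \<alpha>\<close> is again the transfer function of an input
  of a system with the same \<open>A\<close> and \<open>C\<close>.\<close>
lemma transfer_mat_replace_col:
  assumes "D *v \<alpha> = 0" and nz: "det (mat \<sigma> - lift_mat A) \<noteq> 0"
  shows "transfer_mat A (replace_col B j (A *v (B *v \<alpha>))) C (replace_col D j (C *v (B *v \<alpha>))) \<sigma>
    = transfer_mat A B C D \<sigma> ** replace_col (mat 1) j (\<sigma> *s lift_vec \<alpha>)"
proof -
  let ?R = "matrix_inv (mat \<sigma> - lift_mat A)" and ?b = "lift_vec (B *v \<alpha>)"
  have "transfer_mat A B C D \<sigma> *v lift_vec \<alpha>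
      = lift_mat C *v (?R *v ?b) + lift_vec (D *v \<alpha>)"
    by (simp add: transfer_mat_mult_vec lift_vec_mult)
  then have "transfer_mat A B C D \<sigma> *v (\<sigma> *s lift_vec \<alpha>) = \<sigma> *s (lift_mat C *v (?R *v ?b))"
    by (simp add: assms vector_scalar_commute)
  also have "\<dots> = lift_mat C *v (?R *v (lift_mat A *v ?b)) + lift_mat C *v ?b"
    by (simp add: resolvent_mult[OF nz] matrix_vector_mult_diff_distrib vector_scalar_commute)
  finally have "transfer_mat A B C D \<sigma> *v (\<sigma> *s lift_vec \<alpha>)
      = lift_mat C *v (?R *v (lift_mat A *v ?b)) + lift_mat C *v ?b" .
  \<comment> \<open>Both sides agree outside column \<open>j\<close>, and the identity just found
    compares column \<open>j\<close>.\<close>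
  then show ?thesis
    by (simp add: mult_replace_col)
      (simp add: transfer_mat_def lift_mat_replace_col mult_replace_col replace_col_add
        lift_vec_mult lift_mat_mult matrix_vector_mul_assoc matrix_mul_assoc)
qed

lemma left_invertible_mult:
  assumes "left_invertible G" "det T \<noteq> 0"
  shows "left_invertible (G ** T)"
proof -
  obtain L where "L ** G = mat 1" using assms by (auto simp: left_invertible_def)
  then have "(matrix_inv T ** L) ** (G ** T) = mat 1"
    by (metis matrix_inv_det_nz(2)[OF assms(2)] matrix_mul_assoc matrix_mul_rid)
  then show ?thesis by (auto simp: left_invertible_def)
qed

text \<open>With b = B \<alpha>, a step of the new system from w with input v is a step of the old
  one from w + v_j b with component j of v removed. Conversely, an old step is a new step up to a
  multiple of b.\<close>

lemma strongly_reachable_replace_col: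
  fixes A :: "real^'n^'n" and B :: "real^'m^'n" and C :: "real^'n^'p" and D :: "real^'m^'p"
  assumes "D *v \<alpha> = 0" "\<alpha>$j = 1"
  defines "B' \<equiv> replace_col B j (A *v (B *v \<alpha>))" and "D' \<equiv> replace_col D j (C *v (B *v \<alpha>))"
  shows "strongly_reachable A B C D = span (insert (B *v \<alpha>) (strongly_reachable A B' C D'))"
proof -
  let ?b = "B *v \<alpha>"
  have B': "B' *v v = B *v (v - axis j (v$j)) + v$j *\<^sub>R (A *v ?b)" for v
    unfolding B'_def replace_col_mult_vec by (simp add: scalar_mult_eq_scaleR)
  have D': "D' *v v = D *v (v - axis j (v$j)) + v$j *\<^sub>R (C *v ?b)" for v
    unfolding D'_def replace_col_mult_vec by (simp add: scalar_mult_eq_scaleR)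
  \<comment> \<open>One step from 0 with input \<alpha>, admissible since D \<alpha> = 0.\<close>
  have b: "?b \<in> strongly_reachable A B C D"
    using strongly_reachable_step[OF subspace_0[OF subspace_strongly_reachable], of C D \<alpha> A B]
      assms(1) by simp
  have "x \<in> strongly_reachable A B C D" if "x \<in> strongly_reachable A B' C D'" for x
    using that
  proof (induction rule: strongly_reachable_induct)
    case zero
    show ?case by (rule subspace_0[OF subspace_strongly_reachable])
  next
    case (step w v)
    let ?w = "w + v$j *\<^sub>R ?b" and ?v = "v - axis j (v$j)"
    have "?w \<in> strongly_reachable A B C D"
      using step.IH b subspace_strongly_reachable by (blast intro: subspace_add subspace_scale)
    moreover have "C *v ?w + D *v ?v = 0"
      using step.hyps by (simp add: D' matrix_vector_right_distrib matrix_vector_mult_scaleR add_ac)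
    ultimately have "A *v ?w + B *v ?v \<in> strongly_reachable A B C D"
      by (rule strongly_reachable_step)
    then show ?case
      by (simp add: B' matrix_vector_right_distrib matrix_vector_mult_scaleR add_ac)
  qed
  then have "span (insert ?b (strongly_reachable A B' C D')) \<subseteq> strongly_reachable A B C D"
    using b by (intro span_minimal subspace_strongly_reachable) auto
  moreover have "x \<in> span (insert ?b (strongly_reachable A B' C D'))"
    if "x \<in> strongly_reachable A B C D" for x
    using that
  proof (induction rule: strongly_reachable_induct)
    case zero
    show ?case by (rule span_zero)
  next
    case (step w v)
    obtain c where "w - c *\<^sub>R ?b \<in> span (strongly_reachable A B' C D')"
      using step.IH by (auto simp: span_insert)
    then have c: "w - c *\<^sub>R ?b \<in> strongly_reachable A B' C D'"
      using subspace_strongly_reachable by (metis span_eq_iff)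
    \<comment> \<open>Subtracting v_j \<alpha> clears component \<open>j\<close> and costs only v_j
      b in the next state. Setting that component to \<open>c\<close> lets the new columns supply c
      A b and c C b, which restores the part c b removed from w.\<close>
    define v0 v1 where "v0 = v - v$j *\<^sub>R \<alpha>" "v1 = v0 + axis j c"
    have v1: "v1$j = c" "v1 - axis j c = v0"
      using assms(2) by (simp_all add: v0_v1_def axis_def)
    have "C *v (w - c *\<^sub>R ?b) + D' *v v1 = 0"
      using step.hyps by (simp add: D' v1 v0_v1_def(1) matrix_vector_mult_diff_distrib
          matrix_vector_mult_scaleR assms(1))
    then have "A *v (w - c *\<^sub>R ?b) + B' *v v1 \<in> strongly_reachable A B' C D'"
      by (rule strongly_reachable_step[OF c])
    then have "A *v (w - c *\<^sub>R ?b) + B' *v v1 + v$j *\<^sub>R ?b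
        \<in> span (insert ?b (strongly_reachable A B' C D'))"
      by (intro span_add[OF span_base span_scale[OF span_base]]) auto
    also have "A *v (w - c *\<^sub>R ?b) + B' *v v1 + v$j *\<^sub>R ?b = A *v w + B *v v"
      by (simp add: B' v1 v0_v1_def(1) matrix_vector_mult_diff_distrib matrix_vector_mult_scaleR)
    finally show ?case .
  qed
  ultimately show ?thesis by blast
qed

text \<open>A polynomial input u for B \<alpha> would satisfy G T u = - G \<alpha>, where T is the
  column replacement by s \<alpha>. Cancelling G leaves T u = - \<alpha>.\<close>

lemma not_strongly_reachable_replace_col:
  assumes inv: "left_invertible (transfer_mat A B C D s_var)"
    and \<alpha>: "D *v \<alpha> = 0" "\<alpha>$j = 1"
  shows "B *v \<alpha> \<notin> strongly_reachable A (replace_col B j (A *v (B *v \<alpha>))) C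
    (replace_col D j (C *v (B *v \<alpha>)))"
proof
  let ?G = "transfer_mat A B C D s_var" and ?T = "replace_col (mat 1) j (s_var *s lift_vec \<alpha>)"
  let ?R = "matrix_inv (mat s_var - lift_mat A)"
  assume "B *v \<alpha> \<in> strongly_reachable A (replace_col B j (A *v (B *v \<alpha>))) C
    (replace_col D j (C *v (B *v \<alpha>)))"
  from strongly_reachable_polynomial_input[OF this] obtain u where
    u: "?G ** ?T *v (\<chi> i. to_fract (u$i)) = - (lift_mat C *v (?R *v lift_vec (B *v \<alpha>)))"
    unfolding transfer_mat_replace_col[OF \<alpha>(1) det_pencil_s_var_nz(1)] by blast
  have "?G *v lift_vec \<alpha> = lift_mat C *v (?R *v lift_vec (B *v \<alpha>)) + lift_vec (D *v \<alpha>)"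
    by (simp add: transfer_mat_mult_vec lift_vec_mult)
  then have "?G *v (?T *v (\<chi> i. to_fract (u$i)) + lift_vec \<alpha>) = 0"
    using u by (simp add: \<alpha> matrix_vector_right_distrib matrix_vector_mul_assoc)
  moreover obtain L where "L ** ?G = mat 1"
    using inv by (auto simp: left_invertible_def)
  ultimately have "?T *v (\<chi> i. to_fract (u$i)) + lift_vec \<alpha> = 0"
    by (metis matrix_vector_mul_assoc matrix_vector_mul_lid matrix_vector_mult_0_right)
  \<comment> \<open>Since \<alpha>_j = 1, component \<open>j\<close> reads s u_j + 1 = 0, which
    fails at s = 0.\<close>
  then have "(?T *v (\<chi> i. to_fract (u$i)) + lift_vec \<alpha>) $ j = 0" by simp
  then have "to_fract (u$j * [:0, 1:] + 1) = 0"
    by (simp add: replace_col_mult_vec axis_def lift_vec_def \<alpha> s_var_eq del: mult_pCons_left mult_pCons_right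
        flip: one_pCons)
  then have "u$j * [:0, 1:] + 1 = 0" by (simp only: to_fract_eq_0_iff)
  then have "poly (u$j * [:0, 1:] + 1) 0 = 0" by (metis poly_0)
  then show False by simp
qed

section \<open>Induction on the dimension and conclusion\<close>

text \<open>\<open>A\<close> and \<open>C\<close> stay fixed while \<open>B\<close> and
  \<open>D\<close> change. Nonvanishing is carried along because additivity of degrees requires
  nonzero factors.\<close>

lemma degree_det_cascade_pencil:
  fixes A :: "real^'n^'n" and B :: "real^'m^'n" and C :: "real^'n^'p" and D :: "real^'m^'p"
  assumes "left_invertible (transfer_mat A B C D s_var)"
  shows "det (cascade_pencil A B C D) \<noteq> 0 \<and>
    degree (det (cascade_pencil A B C D)) + 2 * dim (strongly_reachable A B C D) = 2 * CARD('n)"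
  using assms
proof (induction "dim (strongly_reachable A B C D)" arbitrary: B D rule: less_induct)
  case less
  show ?case
  proof (cases "\<forall>v. D *v v = 0 \<longrightarrow> v = 0")
    case True
    \<comment> \<open>From state 0 the constraint reads D v = 0, so v = 0 and the state stays
      0.\<close>
    have "x = 0" if "x \<in> strongly_reachable A B C D" for x
      using that by (induction rule: strongly_reachable_induct) (use True in auto)
    then have "dim (strongly_reachable A B C D) = 0" by auto
    then show ?thesis using degree_det_cascade_pencil_injective[of D A B C] True by auto
  next
    case False
    then obtain v j where v: "D *v v = 0" "v$j \<noteq> 0"
      by (metis vec_eq_iff zero_index)
    define \<alpha> where "\<alpha> = inverse (v$j) *\<^sub>R v"
    have \<alpha>: "D *v \<alpha> = 0" "\<alpha>$j = 1"
      using v by (simp_all add: \<alpha>_def matrix_vector_mult_scaleR)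
    define B' where "B' = replace_col B j (A *v (B *v \<alpha>))"
    define D' where "D' = replace_col D j (C *v (B *v \<alpha>))"
    define T where "T \<sigma> = replace_col (mat 1) j (\<sigma> *s lift_vec \<alpha>)" for \<sigma>
    have det_T: "det (T \<sigma>) = \<sigma>" for \<sigma>
      by (simp add: T_def det_replace_col_mat_1 lift_vec_def \<alpha> flip: one_pCons)
    have tr: "transfer_mat A B' C D' s_var = transfer_mat A B C D s_var ** T s_var"
      "transfer_mat A B' C D' (- s_var) = transfer_mat A B C D (- s_var) ** T (- s_var)"
      unfolding B'_def D'_def T_def
      by (intro transfer_mat_replace_col \<alpha> det_pencil_s_var_nz)+
    have inv': "left_invertible (transfer_mat A B' C D' s_var)"
      unfolding tr by (intro left_invertible_mult less.prems) (simp add: det_T)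
    have "dim (strongly_reachable A B C D)
        = dim (insert (B *v \<alpha>) (strongly_reachable A B' C D'))"
      unfolding B'_def D'_def by (subst strongly_reachable_replace_col[OF \<alpha>]) simp
    \<comment> \<open>The adjoined vector lies outside a subspace, so it adds exactly one
      dimension.\<close>
    also have "\<dots> = dim (strongly_reachable A B' C D') + 1"
      using not_strongly_reachable_replace_col[OF less.prems \<alpha>]
      by (simp add: dim_insert B'_def D'_def span_eq_iff[THEN iffD2] subspace_strongly_reachable)
    finally have dim: "dim (strongly_reachable A B C D) = dim (strongly_reachable A B' C D') + 1" .
    have gram: "transpose (X ** Y) ** (Z ** W) = transpose Y ** (transpose X ** Z) ** W"
      for X Z :: "ratfun^'m^'p" and Y W :: "ratfun^'m^'m"
      by (simp add: matrix_transpose_mul matrix_mul_assoc)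
    \<comment> \<open>The pencils depend on \<open>A\<close> alone; only the Gram determinant
      changes, by det T(-s) = -s and det T(s) = s.\<close>
    have "to_fract (det (cascade_pencil A B' C D'))
        = to_fract ([:0, 1:] * [:0, -1:] * det (cascade_pencil A B C D))"
      unfolding to_fract_mult det_cascade_pencil tr s_var_eq[symmetric] minus_s_var_eq[symmetric]
        gram by (simp add: det_mul det_T)
    then have det': "det (cascade_pencil A B' C D') = [:0, 1:] * [:0, -1:] * det (cascade_pencil A B C D)"
      by (simp only: to_fract_eq_iff)
    have IH: "det (cascade_pencil A B' C D') \<noteq> 0"
      "degree (det (cascade_pencil A B' C D')) + 2 * dim (strongly_reachable A B' C D') = 2 * CARD('n)"
      using less.hyps[OF _ inv'] dim by auto
    have nz: "det (cascade_pencil A B C D) \<noteq> 0"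
      using IH(1) unfolding det' by auto
    then have "degree (det (cascade_pencil A B' C D')) = 2 + degree (det (cascade_pencil A B C D))"
      unfolding det' by (subst degree_mult_eq) auto
    then show ?thesis using IH(2) dim nz by simp
  qed
qed

theorem mainTheorem8:
  fixes A :: "real^'n^'n" and B :: "real^'m^'n" and C :: "real^'n^'p" and D :: "real^'m^'p"
  assumes "left_invertible (transfer_mat A B C D s_var)"
  shows "\<exists>q :: real poly.
           Fract q 1 = det (mat s_var - lift_mat A) * det (mat (- s_var) - lift_mat A)
                       * det (transpose (transfer_mat A B C D (- s_var)) ** transfer_mat A B C D s_var)
         \<and> dim (strongly_reachable A B C D) = CARD('n) - degree q div 2
         \<and> even (degree q)"
proof (intro exI conjI)
  let ?q = "det (cascade_pencil A B C D)"
  show "Fract ?q 1 = det (mat s_var - lift_mat A) * det (mat (- s_var) - lift_mat A)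
      * det (transpose (transfer_mat A B C D (- s_var)) ** transfer_mat A B C D s_var)"
    by (simp add: det_cascade_pencil flip: to_fract_def)
  have "degree ?q + 2 * dim (strongly_reachable A B C D) = 2 * CARD('n)"
    using degree_det_cascade_pencil[OF assms] by simp
  \<comment> \<open>The identity also bounds the degree by 2n, so the subtraction of naturals is not
    truncated.\<close>
  then show "dim (strongly_reachable A B C D) = CARD('n) - degree ?q div 2" "even (degree ?q)"
    by presburger+
qed

end
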